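(* Let $d_1,d_2$ be nonzero integers, $f$ a positive integer, and $m_1,m_2,n_1,n_2\in\mathbb{Z}$; write $\vec m=(m_1,m_2)$, $\vec n=(n_1,n_2)$. The fine Kloosterman sum $\mathscr{S}_{w_0}(\vec m,\vec n;d_1,d_2,f)$ is zero unless $\gcd(m_2d_2,f)=\gcd(n_2d_1,f)$. If this condition holds, then \[ \mathscr{S}_{w_0}(\vec m,\vec n;d_1,d_2,f)= f\sum_{\substack{x_3,y_3 \bmod f\\ x_3y_3\equiv 1 \ (\mathrm{mod}\ f)\\ m_2d_2+n_2d_1y_3\equiv 0\ (\mathrm{mod}\ f)}} S\!\left(n_1,\tfrac{m_2d_2+n_2d_1y_3}{f};d_1\right)\, S\!\left(m_1,\tfrac{n_2d_1+m_2d_2x_3}{f};d_2\right), \] where the sum runs over pairs of residue classes $x_3,y_3$ modulo $f$ (with any integer representatives).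
   Context: Notation: $e(z)=e^{2\pi i z}$. $U_3(R)$ denotes the group of $3\times 3$ upper triangular unipotent matrices with entries in $R$, and $\Gamma_\infty=U_3(\mathbb{Z})$. Let $w_0=\begin{pmatrix}0&0&1\\0&-1&0\\1&0&0\end{pmatrix}$ and for nonzero reals $c_1,c_2$ let $t(c_1,c_2)=\mathrm{diag}(c_1,c_2/c_1,1/c_2)$. Every $A\in \mathrm{SL}_3(\mathbb{R})$ with $A_{31}\neq 0$ and $A_{21}A_{32}-A_{22}A_{31}\neq 0$ has a unique decomposition $A=u_L(A)\,w_0\,t\,u_R(A)$ with $u_L(A),u_R(A)\in U_3(\mathbb{R})$ and $t$ diagonal; then $t=t(A_{31},A_{21}A_{32}-A_{22}A_{31})$. For $\vec n=(n_1,n_2)\in\mathbb{Z}^2$ and $u=(u_{ij})\in U_3(\mathbb{R})$ put $\psi_{\vec n}(u)=e(n_1u_{12}+n_2u_{23})$. For nonzero integers $d_1,d_2$ and a positive integer $f$, the fine Kloosterman set is $\Omega(d_1,d_2,f)=\{A\in \mathrm{SL}_3(\mathbb{Z}):\ \gcd(A_{31},A_{32})=f,\ A_{31}=d_1f,\ A_{21}A_{32}-A_{22}A_{31}=d_2f\}$; it is invariant under left and right multiplication by $\Gamma_\infty$. The fine Kloosterman sum is $\mathscr{S}_{w_0}(\vec m,\vec n;d_1,d_2,f)=\sum_{A\in\Gamma_\infty\backslash\Omega(d_1,d_2,f)/\Gamma_\infty}\psi_{\vec m}(u_L(A))\psi_{\vec n}(u_R(A))$. The classical Kloosterman sum is $S(m,n;c)=\sum_{a,d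 \bmod c,\ ad\equiv 1 \bmod c} e\big(\frac{ma+nd}{c}\big)$ for a nonzero integer $c$. *)

theory Defs
  imports "HOL-Analysis.Analysis" "HOL-Number_Theory.Cong"
begin

definition ee :: "real \<Rightarrow> complex"
  where "ee z = exp (2 * of_real pi * \<i> * of_real z)"

definition U3 :: "('a::comm_ring_1 ^ 3 ^ 3) set"
  where "U3 = {u. (\<forall>i. u $ i $ i = 1) \<and> u $ 2 $ 1 = 0 \<and> u $ 3 $ 1 = 0 \<and> u $ 3 $ 2 = 0}"

definition SL3 :: "('a::comm_ring_1 ^ 3 ^ 3) set"
  where "SL3 = {A. det A = 1}"

definition w0 :: "real ^ 3 ^ 3"
  where "w0 = vector [vector [0, 0, 1], vector [0, -1, 0], vector [1, 0, 0]]"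

definition diagonal :: "'a::zero ^ 'n ^ 'n \<Rightarrow> bool"
  where "diagonal t \<longleftrightarrow> (\<forall>i j. i \<noteq> j \<longrightarrow> t $ i $ j = 0)"

definition bruhat :: "real ^ 3 ^ 3 \<Rightarrow> real ^ 3 ^ 3 \<Rightarrow> real ^ 3 ^ 3 \<Rightarrow> real ^ 3 ^ 3 \<Rightarrow> bool"
  where "bruhat A u t v \<longleftrightarrow> u \<in> U3 \<and> diagonal t \<and> v \<in> U3 \<and> A = u ** w0 ** t ** v"

text \<open>\<open>bruhat_ex1\<close> below shows that the descriptions in \<open>u_L\<close> and \<open>u_R\<close> are proper on the big cell.\<close>

definition u_L :: "real ^ 3 ^ 3 \<Rightarrow> real ^ 3 ^ 3"
  where "u_L A = (THE u. \<exists>t v. bruhat A u t v)"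

definition u_R :: "real ^ 3 ^ 3 \<Rightarrow> real ^ 3 ^ 3"
  where "u_R A = (THE v. \<exists>u t. bruhat A u t v)"

definition psi :: "int \<times> int \<Rightarrow> real ^ 3 ^ 3 \<Rightarrow> complex"
  where "psi n u = ee (of_int (fst n) * u $ 1 $ 2 + of_int (snd n) * u $ 2 $ 3)"

definition fine_set :: "int \<Rightarrow> int \<Rightarrow> int \<Rightarrow> (int ^ 3 ^ 3) set"
  where "fine_set d1 d2 f = {A \<in> SL3.
    gcd (A $ 3 $ 1) (A $ 3 $ 2) = f \<and> A $ 3 $ 1 = d1 * f \<and>
    A $ 2 $ 1 * A $ 3 $ 2 - A $ 2 $ 2 * A $ 3 $ 1 = d2 * f}"

definition double_coset :: "int ^ 3 ^ 3 \<Rightarrow> (int ^ 3 ^ 3) set"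
  where "double_coset A = {g ** A ** h | g h. g \<in> U3 \<and> h \<in> U3}"

text \<open>The summand is independent of the chosen representative: see \<open>summand_double_coset\<close> below.\<close>

definition fine_kloosterman :: "int \<times> int \<Rightarrow> int \<times> int \<Rightarrow> int \<Rightarrow> int \<Rightarrow> int \<Rightarrow> complex"
  where "fine_kloosterman m n d1 d2 f =
    (\<Sum>C \<in> double_coset ` fine_set d1 d2 f.
       let A = map_matrix real_of_int (SOME A. A \<in> C) in psi m (u_L A) * psi n (u_R A))"

definition kloosterman :: "int \<Rightarrow> int \<Rightarrow> int \<Rightarrow> complex"
  where "kloosterman m n c =
    (\<Sum>(a, d) \<in> {(a, d). a \<in> {0..<\<bar>c\<bar>} \<and> d \<in> {0..<\<bar>c\<bar>} \<and> [a * d = 1] (mod c)}.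
       ee (of_int (m * a + n * d) / of_int c))"

definition residue_reps :: "int \<Rightarrow> int set \<Rightarrow> bool"
  where "residue_reps f X \<longleftrightarrow> (\<forall>k. \<exists>!x. x \<in> X \<and> [x = k] (mod f))"

lemma bruhat_iff:
  "bruhat A u t v \<longleftrightarrow> u \<in> U3 \<and> diagonal t \<and> v \<in> U3 \<and>
    A $ 3 $ 1 = t $ 1 $ 1 \<and> A $ 3 $ 2 = t $ 1 $ 1 * v $ 1 $ 2 \<and> A $ 3 $ 3 = t $ 1 $ 1 * v $ 1 $ 3 \<and>
    A $ 2 $ 1 = u $ 2 $ 3 * t $ 1 $ 1 \<and> A $ 2 $ 2 = - t $ 2 $ 2 + u $ 2 $ 3 * t $ 1 $ 1 * v $ 1 $ 2 \<and>
    A $ 2 $ 3 = - t $ 2 $ 2 * v $ 2 $ 3 + u $ 2 $ 3 * t $ 1 $ 1 * v $ 1 $ 3 \<and>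
    A $ 1 $ 1 = u $ 1 $ 3 * t $ 1 $ 1 \<and> A $ 1 $ 2 = - u $ 1 $ 2 * t $ 2 $ 2 + u $ 1 $ 3 * t $ 1 $ 1 * v $ 1 $ 2 \<and>
    A $ 1 $ 3 = t $ 3 $ 3 - u $ 1 $ 2 * t $ 2 $ 2 * v $ 2 $ 3 + u $ 1 $ 3 * t $ 1 $ 1 * v $ 1 $ 3"
  by (auto simp add: bruhat_def U3_def diagonal_def w0_def matrix_matrix_mult_def sum_3 forall_3 vec_eq_iff)

lemma vec3_eq_iff: "A = B \<longleftrightarrow> (\<forall>i j. A $ i $ j = B $ i $ j)" for A B :: "'a ^ 3 ^ 3"
  by (simp add: vec_eq_iff)

lemma bruhat_unique:
  assumes "bruhat A u t v" "bruhat A u' t' v'"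
    and "A $ 3 $ 1 \<noteq> 0" "A $ 2 $ 1 * A $ 3 $ 2 - A $ 2 $ 2 * A $ 3 $ 1 \<noteq> 0"
  shows "u' = u" "t' = t" "v' = v"
proof -
  note 1 = assms(1)[unfolded bruhat_iff] and 2 = assms(2)[unfolded bruhat_iff]
  have a: "t' $ 1 $ 1 = t $ 1 $ 1" "t $ 1 $ 1 \<noteq> 0" using 1 2 assms(3) by metis+
  have v: "v' $ 1 $ 2 = v $ 1 $ 2" "v' $ 1 $ 3 = v $ 1 $ 3" and u: "u' $ 2 $ 3 = u $ 2 $ 3" "u' $ 1 $ 3 = u $ 1 $ 3"
    using 1 2 a by (metis mult_cancel_left mult_cancel_right)+
  have b: "t' $ 2 $ 2 = t $ 2 $ 2" using 1 2 a v u by (smt (verit))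
  have b0: "t $ 2 $ 2 \<noteq> 0" using 1 assms(4) by auto
  have v2: "v' $ 2 $ 3 = v $ 2 $ 3"
  proof -
    have "t $ 2 $ 2 * v' $ 2 $ 3 = t $ 2 $ 2 * v $ 2 $ 3" using 1 2 a v u b by auto
    with b0 show ?thesis by simp
  qed
  have u2: "u' $ 1 $ 2 = u $ 1 $ 2"
  proof -
    have "u' $ 1 $ 2 * t $ 2 $ 2 = u $ 1 $ 2 * t $ 2 $ 2" using 1 2 a v u b by auto
    with b0 show ?thesis by simp
  qed
  have c: "t' $ 3 $ 3 = t $ 3 $ 3" using 1 2 a v u b v2 u2 by auto
  show "u' = u" "t' = t" "v' = v"
    using 1 2 a v u b v2 u2 c by (auto simp: vec3_eq_iff forall_3 U3_def diagonal_def)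
qed

lemma bruhat_exists:
  fixes A :: "real ^ 3 ^ 3"
  assumes "A \<in> SL3" "A $ 3 $ 1 \<noteq> 0" "A $ 2 $ 1 * A $ 3 $ 2 - A $ 2 $ 2 * A $ 3 $ 1 \<noteq> 0"
  defines "c1 \<equiv> A $ 3 $ 1" and "c2 \<equiv> A $ 2 $ 1 * A $ 3 $ 2 - A $ 2 $ 2 * A $ 3 $ 1"
  shows "\<exists>u v. bruhat A u (vector [vector [c1, 0, 0], vector [0, c2 / c1, 0], vector [0, 0, 1 / c2]]) v"
proof -
  have nz: "c1 \<noteq> 0" "c2 \<noteq> 0" using assms by auto
  let ?v23 = "(A $ 2 $ 1 * A $ 3 $ 3 - A $ 2 $ 3 * c1) / c2"
  let ?u12 = "(A $ 1 $ 1 * A $ 3 $ 2 - A $ 1 $ 2 * c1) / c2"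
  let ?u = "vector [vector [1, ?u12, A $ 1 $ 1 / c1], vector [0, 1, A $ 2 $ 1 / c1], vector [0, 0, 1]] :: real ^ 3 ^ 3"
  let ?v = "vector [vector [1, A $ 3 $ 2 / c1, A $ 3 $ 3 / c1], vector [0, 1, ?v23], vector [0, 0, 1]] :: real ^ 3 ^ 3"
  have d: "A $ 1 $ 1 * A $ 2 $ 2 * A $ 3 $ 3 + A $ 1 $ 2 * A $ 2 $ 3 * c1 + A $ 1 $ 3 * A $ 2 $ 1 * A $ 3 $ 2
      - A $ 1 $ 1 * A $ 2 $ 3 * A $ 3 $ 2 - A $ 1 $ 2 * A $ 2 $ 1 * A $ 3 $ 3 - A $ 1 $ 3 * A $ 2 $ 2 * c1 = 1"
    using assms(1) by (simp add: SL3_def det_3 c1_def)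
  have c2: "A $ 2 $ 1 * A $ 3 $ 2 - A $ 2 $ 2 * c1 = c2" by (simp add: c1_def c2_def)
  have m: "A $ 2 $ 2 = - (c2 / c1) + A $ 2 $ 1 / c1 * c1 * (A $ 3 $ 2 / c1)"
    using nz c2 by (simp add: field_simps)
  have x: "A $ 1 $ 3 = 1 / c2 - ?u12 * (c2 / c1) * ?v23 + A $ 1 $ 1 / c1 * c1 * (A $ 3 $ 3 / c1)"
  proof -
    have "A $ 1 $ 3 * (c1 * c2) = c1 - (A $ 1 $ 1 * A $ 3 $ 2 - A $ 1 $ 2 * c1) *
        (A $ 2 $ 1 * A $ 3 $ 3 - A $ 2 $ 3 * c1) + A $ 1 $ 1 * A $ 3 $ 3 * c2"
      using d c2 by algebra
    hence "A $ 1 $ 3 = (c1 - (A $ 1 $ 1 * A $ 3 $ 2 - A $ 1 $ 2 * c1) *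
        (A $ 2 $ 1 * A $ 3 $ 3 - A $ 2 $ 3 * c1) + A $ 1 $ 1 * A $ 3 $ 3 * c2) / (c1 * c2)"
      using nz by (simp add: eq_divide_eq)
    moreover have "P / c2 * (c2 / c1) * (Q / c2) = P * Q / (c1 * c2)" for P Q using nz by simp
    moreover have "(c1 - P + Q * c2) / (c1 * c2) = 1 / c2 - P / (c1 * c2) + Q / c1" for P Q
      using nz by (simp add: add_divide_distrib diff_divide_distrib)
    ultimately show ?thesis using nz by simp
  qed
  have y: "A $ 2 $ 3 = - (c2 / c1) * ?v23 + A $ 2 $ 1 / c1 * c1 * (A $ 3 $ 3 / c1)"
    and z: "A $ 1 $ 2 = - ?u12 * (c2 / c1) + A $ 1 $ 1 / c1 * c1 * (A $ 3 $ 2 / c1)"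
    using nz by (simp_all add: field_simps)
  have "bruhat A ?u (vector [vector [c1, 0, 0], vector [0, c2 / c1, 0], vector [0, 0, 1 / c2]]) ?v"
    unfolding bruhat_iff vector_3 U3_def diagonal_def forall_3 mem_Collect_eq
    using nz m x y z by (simp add: c1_def)
  thus ?thesis by blast
qed

lemma bruhat_ex1:
  fixes A :: "real ^ 3 ^ 3"
  assumes "A \<in> SL3" "A $ 3 $ 1 \<noteq> 0" "A $ 2 $ 1 * A $ 3 $ 2 - A $ 2 $ 2 * A $ 3 $ 1 \<noteq> 0"
  shows "\<exists>!(u, t, v). bruhat A u t v"
  using bruhat_exists[OF assms] bruhat_unique[OF _ _ assms(2,3)] by (auto intro!: ex_ex1I)

lemma u_L_R_eq:
  assumes "bruhat A u t v" "A $ 3 $ 1 \<noteq> 0" "A $ 2 $ 1 * A $ 3 $ 2 - A $ 2 $ 2 * A $ 3 $ 1 \<noteq> 0"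
  shows "u_L A = u" "u_R A = v"
  unfolding u_L_def u_R_def using assms bruhat_unique by (auto intro!: the_equality)

lemma U3_mult: "g \<in> U3 \<Longrightarrow> h \<in> U3 \<Longrightarrow> g ** h \<in> U3"
  by (simp add: U3_def matrix_matrix_mult_def sum_3 forall_3)

lemma bruhat_mult:
  "bruhat A u t v \<Longrightarrow> g \<in> U3 \<Longrightarrow> h \<in> U3 \<Longrightarrow> bruhat (g ** A ** h) (g ** u) t (v ** h)"
  by (simp add: bruhat_def U3_mult matrix_mul_assoc)

lemma ee_add_int: "ee (x + of_int k) = ee x"
proof -
  have "ee (x + of_int k) = ee x * exp (2 * of_int k * of_real pi * \<i>)"
    unfolding ee_def exp_add[symmetric] by (simp add: algebra_simps)
  thus ?thesis using exp_integer_2pi[of "of_int k"] by simp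
qed

lemma psi_mult_int:
  assumes "g \<in> U3" "u \<in> U3"
  shows "psi n (map_matrix real_of_int g ** u) = psi n u" "psi n (u ** map_matrix real_of_int g) = psi n u"
proof -
  let ?k = "fst n * g $ 1 $ 2 + snd n * g $ 2 $ 3"
  have "psi n (map_matrix real_of_int g ** u) = ee ((fst n * u $ 1 $ 2 + snd n * u $ 2 $ 3) + of_int ?k)"
    "psi n (u ** map_matrix real_of_int g) = ee ((fst n * u $ 1 $ 2 + snd n * u $ 2 $ 3) + of_int ?k)"
    using assms by (simp_all add: psi_def U3_def matrix_matrix_mult_def sum_3 forall_3 algebra_simps)
  thus "psi n (map_matrix real_of_int g ** u) = psi n u" "psi n (u ** map_matrix real_of_int g) = psi n u"
    unfolding ee_add_int by (simp_all add: psi_def)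
qed

lemma summand_double_coset:
  assumes "A \<in> fine_set d1 d2 f" "B \<in> double_coset A" "d1 \<noteq> 0" "d2 \<noteq> 0" "f > 0"
  shows "psi m (u_L (map_matrix real_of_int B)) * psi n (u_R (map_matrix real_of_int B)) =
    psi m (u_L (map_matrix real_of_int A)) * psi n (u_R (map_matrix real_of_int A))"
proof -
  let ?r = "map_matrix real_of_int :: int ^ 3 ^ 3 \<Rightarrow> _"
  obtain g h where gh: "g \<in> U3" "h \<in> U3" and B: "B = g ** A ** h"
    using assms(2) by (auto simp: double_coset_def)
  have rm: "?r (P ** Q) = ?r P ** ?r Q" for P Q
    by (simp add: vec3_eq_iff matrix_matrix_mult_def sum_3)
  have rU: "?r g \<in> U3" "?r h \<in> U3" using gh by (auto simp: U3_def)
  have A31: "A $ 3 $ 1 \<noteq> 0" and A2: "A $ 2 $ 1 * A $ 3 $ 2 - A $ 2 $ 2 * A $ 3 $ 1 \<noteq> 0"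
    using assms by (auto simp: fine_set_def)
  have B31: "B $ 3 $ 1 \<noteq> 0" and B2: "B $ 2 $ 1 * B $ 3 $ 2 - B $ 2 $ 2 * B $ 3 $ 1 \<noteq> 0"
    using gh A31 A2 unfolding B
    by (simp_all add: U3_def matrix_matrix_mult_def sum_3 forall_3 algebra_simps)
  have rn: "?r P $ 2 $ 1 * ?r P $ 3 $ 2 - ?r P $ 2 $ 2 * ?r P $ 3 $ 1 =
      of_int (P $ 2 $ 1 * P $ 3 $ 2 - P $ 2 $ 2 * P $ 3 $ 1)" for P by simp
  have cA: "?r A $ 3 $ 1 \<noteq> 0" "?r A $ 2 $ 1 * ?r A $ 3 $ 2 - ?r A $ 2 $ 2 * ?r A $ 3 $ 1 \<noteq> 0"
    unfolding rn of_int_eq_0_iff using A31 A2 by auto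
  have cB: "?r B $ 3 $ 1 \<noteq> 0" "?r B $ 2 $ 1 * ?r B $ 3 $ 2 - ?r B $ 2 $ 2 * ?r B $ 3 $ 1 \<noteq> 0"
    unfolding rn of_int_eq_0_iff using B31 B2 by auto
  have "det (?r A) = of_int (det A)" by (simp add: det_3)
  hence "?r A \<in> SL3" using assms(1) by (simp add: SL3_def fine_set_def)
  from bruhat_exists[OF this cA] obtain u t v where b: "bruhat (?r A) u t v" by blast
  from bruhat_mult[OF b rU] have b': "bruhat (?r B) (?r g ** u) t (v ** ?r h)" by (simp add: B rm)
  have "u \<in> U3" "v \<in> U3" using b by (auto simp: bruhat_def)
  thus ?thesis
    unfolding u_L_R_eq[OF b cA] u_L_R_eq[OF b' cB] by (simp add: psi_mult_int gh)
qed

end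

theory Submission
  imports Defs
begin

text \<open>The bottom row \<open>(d1 f, a f, y)\<close> of an element of the fine Kloosterman set can be reduced by
  \<open>U3\<close> so that \<open>a\<close> and \<open>y\<close> are fixed representatives of units modulo \<open>d1\<close> and \<open>f\<close>. With
  \<open>a a' = 1 (mod d1)\<close>, the minor of rows 2, 3 and columns 1, 3 is then \<open>y a' d2 + d1 \<beta>\<close>, where \<open>\<beta>\<close>
  is coprime to \<open>d2\<close> and only defined modulo \<open>d2 f\<close>; the triples \<open>(a, y, \<beta>)\<close> parametrise the
  double cosets. Writing \<open>\<beta> = b' + d2 l\<close> with \<open>l\<close> modulo \<open>f\<close>, the phase is linear in \<open>l\<close>: summing over
  \<open>l\<close> gives the factor \<open>f\<close> and the congruence condition, and the remaining sums over \<open>a\<close> and \<open>b'\<close> are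
  classical Kloosterman sums. If the two gcds differ, the congruence condition has no solution.\<close>

section \<open>Unipotent matrices and their double cosets\<close>

definition mat3 :: "'a \<Rightarrow> 'a \<Rightarrow> 'a \<Rightarrow> 'a \<Rightarrow> 'a \<Rightarrow> 'a \<Rightarrow> 'a \<Rightarrow> 'a \<Rightarrow> 'a \<Rightarrow> 'a::zero ^ 3 ^ 3"
  where "mat3 a b c d e f g h i = vector [vector [a, b, c], vector [d, e, f], vector [g, h, i]]"

lemma mat3_nth [simp]:
  "mat3 a b c d e f g h i $ 1 $ 1 = a" "mat3 a b c d e f g h i $ 1 $ 2 = b" "mat3 a b c d e f g h i $ 1 $ 3 = c"
  "mat3 a b c d e f g h i $ 2 $ 1 = d" "mat3 a b c d e f g h i $ 2 $ 2 = e" "mat3 a b c d e f g h i $ 2 $ 3 = f"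
  "mat3 a b c d e f g h i $ 3 $ 1 = g" "mat3 a b c d e f g h i $ 3 $ 2 = h" "mat3 a b c d e f g h i $ 3 $ 3 = i"
  by (simp_all add: mat3_def)

lemma mult3_nth:
  fixes A B :: "'a::comm_ring_1 ^ 3 ^ 3"
  shows "(A ** B) $ i $ j = A $ i $ 1 * B $ 1 $ j + A $ i $ 2 * B $ 2 $ j + A $ i $ 3 * B $ 3 $ j"
  by (simp add: matrix_matrix_mult_def sum_3)

lemma U3_inverse:
  fixes g :: "'a::comm_ring_1 ^ 3 ^ 3"
  assumes "g \<in> U3"
  obtains g' where "g' \<in> U3" "g' ** g = mat 1" "g ** g' = mat 1"
proof
  let ?g = "mat3 1 (- g $ 1 $ 2) (g $ 1 $ 2 * g $ 2 $ 3 - g $ 1 $ 3) 0 1 (- g $ 2 $ 3) 0 0 1"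
  show "?g \<in> U3" "?g ** g = mat 1" "g ** ?g = mat 1"
    using assms by (simp_all add: U3_def vec3_eq_iff mult3_nth forall_3 mat_def algebra_simps)
qed

lemma U3_one: "mat 1 \<in> U3"
  by (simp add: U3_def mat_def)

lemma double_coset_refl: "A \<in> double_coset A"
  unfolding double_coset_def using U3_one matrix_mul_lid matrix_mul_rid by (metis (mono_tags, lifting) mem_Collect_eq)

lemma double_coset_mono:
  assumes "B \<in> double_coset A"
  shows "double_coset B \<subseteq> double_coset A"
proof
  fix C assume "C \<in> double_coset B"
  then obtain g h g' h' where "g \<in> U3" "h \<in> U3" "g' \<in> U3" "h' \<in> U3" "C = g' ** (g ** A ** h) ** h'"
    using assms by (auto simp: double_coset_def)
  hence "C = (g' ** g) ** A ** (h ** h')" "g' ** g \<in> U3" "h ** h' \<in> U3"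
    by (simp_all add: matrix_mul_assoc U3_mult)
  thus "C \<in> double_coset A" unfolding double_coset_def by blast
qed

lemma double_coset_sym:
  assumes "B \<in> double_coset A"
  shows "A \<in> double_coset B"
proof -
  obtain g h where gh: "g \<in> U3" "h \<in> U3" and B: "B = g ** A ** h"
    using assms by (auto simp: double_coset_def)
  obtain g' where g': "g' \<in> U3" "g' ** g = mat 1" using U3_inverse[OF gh(1)] by metis
  obtain h' where h': "h' \<in> U3" "h ** h' = mat 1" using U3_inverse[OF gh(2)] by metis
  have "g' ** B ** h' = (g' ** g) ** A ** (h ** h')" by (simp add: B matrix_mul_assoc)
  also have "\<dots> = A" by (simp add: g' h')
  finally show ?thesis using g'(1) h'(1) unfolding double_coset_def by fastforce
qed

lemma double_coset_eq: "B \<in> double_coset A \<Longrightarrow> double_coset B = double_coset A"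
  by (simp add: double_coset_mono double_coset_sym subset_antisym)

lemma double_coset_leftI: "g \<in> U3 \<Longrightarrow> g ** A \<in> double_coset A"
  unfolding double_coset_def using U3_one matrix_mul_rid by (metis (mono_tags, lifting) mem_Collect_eq)

lemma double_coset_rightI: "h \<in> U3 \<Longrightarrow> A ** h \<in> double_coset A"
  unfolding double_coset_def using U3_one matrix_mul_lid by (metis (mono_tags, lifting) mem_Collect_eq)

text \<open>A left coset of \<open>U3\<close> is determined by its bottom row and its bottom \<open>2 \<times> 2\<close> minors; if
  \<open>A $ 3 $ 1 \<noteq> 0\<close> the third minor is redundant by the Pluecker relation.\<close>

lemma U3_left_equiv:
  fixes A B :: "'a::idom ^ 3 ^ 3"
  assumes "det A = 1" "det B = 1" "A $ 3 $ 1 \<noteq> 0"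
    and row: "B $ 3 $ 1 = A $ 3 $ 1" "B $ 3 $ 2 = A $ 3 $ 2" "B $ 3 $ 3 = A $ 3 $ 3"
    and minor12: "B $ 2 $ 1 * B $ 3 $ 2 - B $ 2 $ 2 * B $ 3 $ 1 = A $ 2 $ 1 * A $ 3 $ 2 - A $ 2 $ 2 * A $ 3 $ 1"
    and minor13: "B $ 2 $ 1 * B $ 3 $ 3 - B $ 2 $ 3 * B $ 3 $ 1 = A $ 2 $ 1 * A $ 3 $ 3 - A $ 2 $ 3 * A $ 3 $ 1"
  shows "\<exists>g \<in> U3. A = g ** B"
proof -
  \<comment> \<open>The adjugate of \<open>B\<close>, so that \<open>g\<close> below is
    \<open>A\<close> times the inverse of \<open>B\<close>.\<close>
  let ?adj = "mat3
    (B$2$2 * B$3$3 - B$2$3 * B$3$2) (B$1$3 * B$3$2 - B$1$2 * B$3$3) (B$1$2 * B$2$3 - B$1$3 * B$2$2)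
    (B$2$3 * B$3$1 - B$2$1 * B$3$3) (B$1$1 * B$3$3 - B$1$3 * B$3$1) (B$1$3 * B$2$1 - B$1$1 * B$2$3)
    (B$2$1 * B$3$2 - B$2$2 * B$3$1) (B$1$2 * B$3$1 - B$1$1 * B$3$2) (B$1$1 * B$2$2 - B$1$2 * B$2$1)"
  define g where "g = A ** ?adj"
  have pluecker: "M$3$1 * (M$2$2 * M$3$3 - M$2$3 * M$3$2) =
      M$3$2 * (M$2$1 * M$3$3 - M$2$3 * M$3$1) - M$3$3 * (M$2$1 * M$3$2 - M$2$2 * M$3$1)"
    for M :: "'a ^ 3 ^ 3"
    by (simp add: algebra_simps)
  have "B$3$1 * (B$2$2 * B$3$3 - B$2$3 * B$3$2) = A$3$1 * (A$2$2 * A$3$3 - A$2$3 * A$3$2)"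
    unfolding pluecker minor12 minor13 unfolding row ..
  hence minor23: "B$2$2 * B$3$3 - B$2$3 * B$3$2 = A$2$2 * A$3$3 - A$2$3 * A$3$2"
    using assms(3) row(1) by simp
  have "?adj ** B = mat (det B)"
    by (simp add: vec3_eq_iff forall_3 mult3_nth mat_def det_3 algebra_simps)
  hence adj: "?adj ** B = mat 1" by (simp add: assms(2))
  have gB: "A = g ** B"
    unfolding g_def matrix_mul_assoc[symmetric] adj by simp
  \<comment> \<open>Since the bottom rows agree, the bottom row of \<open>g\<close> is that of
    \<open>B\<close> times \<open>?adj\<close>, which is the bottom row of
    \<open>mat (det B)\<close>.\<close>
  have "g$3$1 = 0" "g$3$2 = 0" "g$3$3 = det B"
    unfolding g_def mult3_nth mat3_nth row[symmetric] by (simp_all add: det_3 algebra_simps)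
  hence g3: "g$3$1 = 0" "g$3$2 = 0" "g$3$3 = 1" using assms(2) by simp_all
  \<comment> \<open>The first column of \<open>?adj\<close> consists of signed bottom minors, shared
    by \<open>A\<close> and \<open>B\<close>. Column 1 of \<open>g\<close> is thus made of cofactor
    expansions in \<open>A\<close>: \<open>det A\<close> in row 1, a determinant with a repeated row
    in row 2.\<close>
  have col1: "g$i$1 = A$i$1 * (B$2$2 * B$3$3 - B$2$3 * B$3$2) - A$i$2 * (B$2$1 * B$3$3 - B$2$3 * B$3$1) +
      A$i$3 * (B$2$1 * B$3$2 - B$2$2 * B$3$1)" for i
    by (simp add: g_def mult3_nth algebra_simps)
  have "g$1$1 = det A" "g$2$1 = 0"
    unfolding col1 minor12 minor13 minor23 by (simp_all add: det_3 algebra_simps)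
  hence g1: "g$1$1 = 1" "g$2$1 = 0" using assms(1) by simp_all
  have "det g = 1" using assms(1,2) gB by (metis det_mul mult.right_neutral)
  hence "g$2$2 = 1" using g1 g3 by (simp add: det_3)
  hence "g \<in> U3" using g1 g3 by (simp add: U3_def forall_3)
  thus ?thesis using gB by blast
qed

section \<open>Residue systems and pairs of inverse residues\<close>

definition inverse_pairs :: "int \<Rightarrow> int set \<Rightarrow> int set \<Rightarrow> (int \<times> int) set"
  where "inverse_pairs c X Y = {(x, y). x \<in> X \<and> y \<in> Y \<and> [x * y = 1] (mod c)}"

lemma residue_reps_cong_eq: "residue_reps c X \<Longrightarrow> x \<in> X \<Longrightarrow> y \<in> X \<Longrightarrow> [x = y] (mod c) \<Longrightarrow> x = y"
  unfolding residue_reps_def using cong_refl by blast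

lemma residue_reps_obtain:
  assumes "residue_reps c X"
  obtains x where "x \<in> X" "[x = k] (mod c)"
  using assms unfolding residue_reps_def by blast

lemma residue_reps_atLeastLessThan:
  assumes "c \<noteq> 0"
  shows "residue_reps c {0..<\<bar>c\<bar>}"
  unfolding residue_reps_def
proof
  fix k
  have "[k mod \<bar>c\<bar> = k] (mod c)"
    by (metis abs_dvd_iff cong_iff_dvd_diff cong_mod_left cong_refl)
  moreover have "k mod \<bar>c\<bar> \<in> {0..<\<bar>c\<bar>}" using assms by simp
  moreover have "x = k mod \<bar>c\<bar>" if "x \<in> {0..<\<bar>c\<bar>}" "[x = k] (mod c)" for x
  proof -
    have "[x = k] (mod \<bar>c\<bar>)" using that by (simp add: cong_iff_dvd_diff)
    thus ?thesis using that by (simp add: cong_def)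
  qed
  ultimately show "\<exists>!x. x \<in> {0..<\<bar>c\<bar>} \<and> [x = k] (mod c)" by blast
qed

lemma residue_reps_finite:
  assumes "c \<noteq> 0" "residue_reps c X"
  shows "finite X"
proof -
  have "inj_on (\<lambda>x. x mod c) X"
    using residue_reps_cong_eq[OF assms(2)] by (auto simp: inj_on_def cong_def)
  \<comment> \<open>A remainder takes the sign of \<open>c\<close>, hence the interval symmetric
    about zero.\<close>
  moreover have "(\<lambda>x. x mod c) ` X \<subseteq> {-\<bar>c\<bar>..\<bar>c\<bar>}"
  proof (rule image_subsetI)
    fix x
    show "x mod c \<in> {-\<bar>c\<bar>..\<bar>c\<bar>}"
      using abs_mod_less[OF assms(1), of x] by auto
  qed
  ultimately show ?thesis using finite_imageD finite_subset by blast
qed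

lemma inverse_pairs_finite:
  assumes "c \<noteq> 0" "residue_reps c X" "residue_reps c Y"
  shows "finite (inverse_pairs c X Y)"
  by (rule finite_subset[of _ "X \<times> Y"])
    (use residue_reps_finite assms in \<open>auto simp: inverse_pairs_def\<close>)

text \<open>The coefficient of \<open>c\<close> is the quotient that occurs in
  \<open>kloosterman_rep\<close>. With exact identities in place of congruences, the later matrix
  computations become polynomial algebra.\<close>

lemma cong_one_imp_bezout:
  fixes c :: int
  assumes "[x * y = 1] (mod c)"
  shows "x * y + c * ((1 - x * y) div c) = 1"
proof -
  have "c dvd 1 - x * y" using assms by (simp add: cong_iff_dvd_diff dvd_diff_commute)
  thus ?thesis by simp
qed

lemma inverse_pairs_obtain:
  assumes "residue_reps c X" "residue_reps c Y" "coprime k c"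
  obtains x y where "(x, y) \<in> inverse_pairs c X Y" "[x = k] (mod c)"
proof -
  obtain k' where k': "[k * k' = 1] (mod c)" using assms(3) cong_solve_coprime_int by blast
  obtain x where x: "x \<in> X" "[x = k] (mod c)" using residue_reps_obtain[OF assms(1)] .
  obtain y where y: "y \<in> Y" "[y = k'] (mod c)" using residue_reps_obtain[OF assms(2)] .
  have "[x * y = 1] (mod c)" using cong_mult[OF x(2) y(2)] k' cong_trans by blast
  thus ?thesis using that x y by (auto simp: inverse_pairs_def)
qed

lemma inverse_pairs_swap: "(x, y) \<in> inverse_pairs c X Y \<longleftrightarrow> (y, x) \<in> inverse_pairs c Y X"
  by (auto simp: inverse_pairs_def mult.commute)

text \<open>Inverses are unique modulo \<open>c\<close>, so the first component fixes the second;
  with \<open>inverse_pairs_swap\<close>, either component fixes the pair.\<close>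

lemma inverse_pairs_eqI:
  assumes "residue_reps c X" "residue_reps c Y"
    and "(x, y) \<in> inverse_pairs c X Y" "(x', y') \<in> inverse_pairs c X Y" "[x = x'] (mod c)"
  shows "x = x' \<and> y = y'"
proof -
  have "x = x'"
    using assms residue_reps_cong_eq by (auto simp: inverse_pairs_def)
  moreover have "[y = y'] (mod c)"
  proof -
    have 1: "[x * y = 1] (mod c)" "[x * y' = 1] (mod c)" using assms(3,4) \<open>x = x'\<close> by (auto simp: inverse_pairs_def)
    hence "[x * y = x * y'] (mod c)" by (meson cong_sym cong_trans)
    moreover have "coprime x c" using 1(1) coprime_iff_invertible_int by blast
    ultimately show ?thesis by (simp add: cong_mult_lcancel)
  qed
  ultimately show ?thesis using assms residue_reps_cong_eq by (auto simp: inverse_pairs_def)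
qed

lemma kloosterman_inverse_pairs:
  "kloosterman m n c = (\<Sum>(a, d) \<in> inverse_pairs c {0..<\<bar>c\<bar>} {0..<\<bar>c\<bar>}. ee (of_int (m * a + n * d) / of_int c))"
  by (simp add: kloosterman_def inverse_pairs_def)

section \<open>The additive character and the phase of a matrix\<close>

lemma ee_add: "ee (x + y) = ee x * ee y"
  by (simp add: ee_def algebra_simps exp_add)

lemma ee_of_nat_mult: "ee (of_nat n * x) = ee x ^ n"
  by (simp add: ee_def algebra_simps flip: exp_of_nat_mult)

lemma ee_of_int: "ee (of_int k) = 1"
  using ee_add_int[of 0 k] by (simp add: ee_def)

lemma ee_eq_1_iff: "ee x = 1 \<longleftrightarrow> x \<in> \<int>"
proof
  assume "ee x = 1"
  then obtain k :: int where "2 * pi * x = of_int (2 * k) * pi"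
    unfolding ee_def exp_eq_1 by auto
  hence "x = of_int k" by simp
  thus "x \<in> \<int>" by simp
qed (auto elim!: Ints_cases simp: ee_of_int)

text \<open>A geometric sum whose ratio \<open>r\<close> satisfies \<open>r ^ nat f = 1\<close>,
  with \<open>r = 1\<close> exactly when \<open>f\<close> divides \<open>k\<close>.\<close>

lemma sum_ee_linear:
  fixes f k :: int
  assumes "f > 0"
  shows "(\<Sum>l\<in>{0..<f}. ee (of_int (k * l) / of_int f)) = (if f dvd k then of_int f else 0)"
proof -
  define r where "r = ee (of_int k / of_int f)"
  have "(\<Sum>l\<in>{0..<f}. ee (of_int (k * l) / of_int f)) = (\<Sum>i<nat f. r ^ i)"
    by (rule sum.reindex_bij_witness[of _ int nat])
      (auto simp: r_def algebra_simps simp flip: ee_of_nat_mult)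
  also have "\<dots> = (if f dvd k then of_int f else 0)"
  proof (cases "f dvd k")
    case True
    then obtain j where "k = f * j" by blast
    hence "r = 1" using assms by (simp add: r_def ee_of_int)
    thus ?thesis using True assms by simp
  next
    case False
    have "r \<noteq> 1"
    proof
      assume "r = 1"
      then obtain j :: int where "real_of_int k / real_of_int f = of_int j"
        unfolding r_def ee_eq_1_iff by (auto elim: Ints_cases)
      hence "real_of_int k = of_int (f * j)" using assms by (simp add: field_simps)
      hence "k = f * j" by linarith
      thus False using False by simp
    qed
    moreover have "r ^ nat f = 1"
      using assms ee_of_int[of k] by (simp add: r_def flip: ee_of_nat_mult)
    ultimately show ?thesis using False by (simp add: sum_gp_strict)
  qed
  finally show ?thesis .
qed

text \<open>In the Bruhat decomposition \<open>t $ 2 $ 2 * t $ 1 $ 1\<close> is the minor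
  \<open>d2 * f\<close>. Dividing two other minors by it gives \<open>u $ 1 $ 2\<close> and
  \<open>v $ 2 $ 3\<close>; dividing entries by \<open>t $ 1 $ 1 = d1 * f\<close> gives
  \<open>u $ 2 $ 3\<close> and \<open>v $ 1 $ 2\<close>.\<close>

lemma psi_product_fine_set:
  fixes A :: "int ^ 3 ^ 3"
  assumes "A \<in> fine_set d1 d2 f" "d1 \<noteq> 0" "d2 \<noteq> 0" "f > 0"
  defines "R \<equiv> map_matrix real_of_int A"
  shows "psi (m1, m2) (u_L R) * psi (n1, n2) (u_R R) =
    ee (m1 * (A$1$1 * A$3$2 - A$1$2 * A$3$1) / (d2 * f) + m2 * A$2$1 / (d1 * f) +
        n1 * A$3$2 / (d1 * f) + n2 * (A$2$1 * A$3$3 - A$2$3 * A$3$1) / (d2 * f))"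
proof -
  have A: "det A = 1" "A$3$1 = d1 * f" "A$2$1 * A$3$2 - A$2$2 * A$3$1 = d2 * f"
    using assms(1) by (auto simp: fine_set_def SL3_def)
  have R: "R$i$j = of_int (A$i$j)" for i j by (simp add: R_def)
  have c2: "R$2$1 * R$3$2 - R$2$2 * R$3$1 = of_int (d2 * f)"
    unfolding R using A(3) by (metis of_int_diff of_int_mult)
  have c1: "R$3$1 = of_int (d1 * f)" by (simp add: R A(2))
  have nz: "R$3$1 \<noteq> 0" "R$2$1 * R$3$2 - R$2$2 * R$3$1 \<noteq> 0"
    unfolding c2 unfolding c1 of_int_eq_0_iff using assms by auto
  have "det R = of_int (det A)" by (simp add: R_def det_3)
  hence "R \<in> SL3" using A by (simp add: SL3_def)
  from bruhat_exists[OF this nz] obtain u t v where b: "bruhat R u t v" by blast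
  have B: "R$3$1 = t$1$1" "R$3$2 = t$1$1 * v$1$2" "R$3$3 = t$1$1 * v$1$3" "R$2$1 = u$2$3 * t$1$1"
    "R$2$2 = - t$2$2 + u$2$3 * t$1$1 * v$1$2" "R$2$3 = - t$2$2 * v$2$3 + u$2$3 * t$1$1 * v$1$3"
    "R$1$1 = u$1$3 * t$1$1" "R$1$2 = - u$1$2 * t$2$2 + u$1$3 * t$1$1 * v$1$2"
    using b unfolding bruhat_iff by blast+
  have t1: "t$1$1 = R$3$1" "t$1$1 \<noteq> 0" using B nz by auto
  have t2: "t$2$2 * t$1$1 = R$2$1 * R$3$2 - R$2$2 * R$3$1"
    unfolding B by (simp add: algebra_simps)
  have u23: "u$2$3 = R$2$1 / of_int (d1 * f)" using B t1 c1 by simp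
  have v12: "v$1$2 = R$3$2 / of_int (d1 * f)" using B t1 c1 by simp
  have "u$1$2 * (t$2$2 * t$1$1) = R$1$1 * R$3$2 - R$1$2 * R$3$1"
    unfolding B by (simp add: algebra_simps)
  hence u12: "u$1$2 = (R$1$1 * R$3$2 - R$1$2 * R$3$1) / of_int (d2 * f)"
    using nz(2) unfolding t2 c2 by (simp add: eq_divide_eq)
  have "v$2$3 * (t$2$2 * t$1$1) = R$2$1 * R$3$3 - R$2$3 * R$3$1"
    unfolding B by (simp add: algebra_simps)
  hence v23: "v$2$3 = (R$2$1 * R$3$3 - R$2$3 * R$3$1) / of_int (d2 * f)"
    using nz(2) unfolding t2 c2 by (simp add: eq_divide_eq)
  show ?thesis
    unfolding u_L_R_eq[OF b nz] psi_def u12 u23 v12 v23 fst_conv snd_conv ee_add[symmetric] R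
    by (simp add: algebra_simps)
qed


section \<open>Representatives of the double cosets\<close>

text \<open>The matrix below is the product of
  \<open>[[-x h, -b, z h], [x \<beta>, -d2, -z \<beta>], [f, 0, y]]\<close> and \<open>[[d1, a, 0], [-a', e, 0], [0, 0, 1]]\<close>, where
  \<open>x y + f z = b \<beta> + d2 h = a a' + d1 e = 1\<close>; its determinant is the product of these three expressions.\<close>

definition kloosterman_rep :: "int \<Rightarrow> int \<Rightarrow> int \<Rightarrow> (int \<times> int) \<times> (int \<times> int) \<times> (int \<times> int) \<times> int \<Rightarrow> int ^ 3 ^ 3"
  where "kloosterman_rep d1 d2 f = (\<lambda>((a, a'), (b, b'), (x, y), l).
    let \<beta> = b' + d2 * l; e = (1 - a * a') div d1; h = (1 - b * \<beta>) div d2; z = (1 - x * y) div f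
    in mat3 (b * a' - x * h * d1) (- x * h * a - b * e) (z * h)
         (x * \<beta> * d1 + d2 * a') (x * \<beta> * a - d2 * e) (- z * \<beta>)
         (d1 * f) (f * a) y)"

text \<open>Modulo \<open>d1\<close> and \<open>d2\<close> the representatives are those built into
  \<open>kloosterman\<close>; modulo \<open>f\<close> they stay arbitrary, as the final formula
  allows any systems there.\<close>

definition kloosterman_params :: "int \<Rightarrow> int \<Rightarrow> int \<Rightarrow> int set \<Rightarrow> int set \<Rightarrow>
    ((int \<times> int) \<times> (int \<times> int) \<times> (int \<times> int) \<times> int) set"
  where "kloosterman_params d1 d2 f X Y =
    inverse_pairs d1 {0..<\<bar>d1\<bar>} {0..<\<bar>d1\<bar>} \<times> inverse_pairs d2 {0..<\<bar>d2\<bar>} {0..<\<bar>d2\<bar>} \<times>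
    inverse_pairs f X Y \<times> {0..<f}"

text \<open>Hides the integer quotients in \<open>kloosterman_rep\<close> behind letters
  \<open>e\<close>, \<open>h\<close>, \<open>z\<close> known only through their Bezout identities.
  The quotient for \<open>h\<close> is exact because adding \<open>d2 * l\<close> to
  \<open>b'\<close> keeps it inverse to \<open>b\<close> modulo \<open>d2\<close>.\<close>

lemma kloosterman_rep_bezout:
  assumes "((a, a'), (b, b'), (x, y), l) \<in> kloosterman_params d1 d2 f X Y"
  obtains e h z where "a * a' + d1 * e = 1" "b * (b' + d2 * l) + d2 * h = 1" "x * y + f * z = 1"
    "kloosterman_rep d1 d2 f ((a, a'), (b, b'), (x, y), l) =
      mat3 (b * a' - x * h * d1) (- x * h * a - b * e) (z * h)
         (x * (b' + d2 * l) * d1 + d2 * a') (x * (b' + d2 * l) * a - d2 * e) (- z * (b' + d2 * l))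
         (d1 * f) (f * a) y"
proof -
  have c: "[a * a' = 1] (mod d1)" "[b * b' = 1] (mod d2)" "[x * y = 1] (mod f)"
    using assms by (auto simp: kloosterman_params_def inverse_pairs_def)
  have "[b * (b' + d2 * l) = b * b'] (mod d2)"
    by (simp add: cong_iff_dvd_diff algebra_simps)
  hence "[b * (b' + d2 * l) = 1] (mod d2)" using c(2) cong_trans by blast
  from cong_one_imp_bezout[OF this] cong_one_imp_bezout[OF c(1)] cong_one_imp_bezout[OF c(3)]
  show ?thesis by (rule_tac that) (simp_all add: kloosterman_rep_def Let_def)
qed

text \<open>Together with the bottom row and the minor \<open>d2 * f\<close>, this value determines
  the left coset of the representative.\<close>

lemma kloosterman_rep_minor13:
  assumes "((a, a'), (b, b'), (x, y), l) \<in> kloosterman_params d1 d2 f X Y"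
  defines "M \<equiv> kloosterman_rep d1 d2 f ((a, a'), (b, b'), (x, y), l)"
  shows "M$2$1 * M$3$3 - M$2$3 * M$3$1 = y * a' * d2 + d1 * (b' + d2 * l)"
proof -
  obtain e h z where xy: "x * y + f * z = 1" and M: "M =
      mat3 (b * a' - x * h * d1) (- x * h * a - b * e) (z * h)
         (x * (b' + d2 * l) * d1 + d2 * a') (x * (b' + d2 * l) * a - d2 * e) (- z * (b' + d2 * l))
         (d1 * f) (f * a) y"
    using kloosterman_rep_bezout[OF assms(1)] unfolding M_def by metis
  show ?thesis unfolding M mat3_nth using xy by algebra
qed

lemma kloosterman_rep_fine_set:
  assumes p: "p \<in> kloosterman_params d1 d2 f X Y" and "f > 0"
  shows "kloosterman_rep d1 d2 f p \<in> fine_set d1 d2 f"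
proof -
  obtain a a' b b' x y l where p': "p = ((a, a'), (b, b'), (x, y), l)" by (metis surj_pair)
  obtain e h z where bez: "a * a' + d1 * e = 1" "b * (b' + d2 * l) + d2 * h = 1" "x * y + f * z = 1"
    and M: "kloosterman_rep d1 d2 f p =
      mat3 (b * a' - x * h * d1) (- x * h * a - b * e) (z * h)
         (x * (b' + d2 * l) * d1 + d2 * a') (x * (b' + d2 * l) * a - d2 * e) (- z * (b' + d2 * l))
         (d1 * f) (f * a) y"
    using kloosterman_rep_bezout[OF p[unfolded p']] unfolding p' by metis
  have "coprime d1 a"
    using bez(1) by (intro coprimeI) (metis dvd_add dvd_mult2)
  hence "gcd (d1 * f) (f * a) = f"
    using assms(2) by (simp add: mult.commute[of d1] gcd_mult_distrib_int[symmetric])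
  moreover have "det (kloosterman_rep d1 d2 f p) = 1"
  proof -
    define \<beta> where "\<beta> = b' + d2 * l"
    have "det (kloosterman_rep d1 d2 f p) = (b * \<beta> + d2 * h) * (a * a' + d1 * e) * (x * y + f * z)"
      unfolding M det_3 mat3_nth \<beta>_def[symmetric] by algebra
    thus ?thesis using bez by (simp add: \<beta>_def)
  qed
  moreover have "(x * (b' + d2 * l) * d1 + d2 * a') * (f * a) - (x * (b' + d2 * l) * a - d2 * e) * (d1 * f) = d2 * f"
    using bez(1) by algebra
  ultimately show ?thesis by (simp add: M fine_set_def SL3_def)
qed

text \<open>The bottom row and the bottom minors do not see the left factor \<open>g\<close>.
  Following how \<open>h\<close> moves them recovers \<open>a\<close> modulo \<open>d1\<close>, then
  \<open>y\<close> modulo \<open>f\<close>, and finally \<open>b' + d2 * l\<close> modulo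
  \<open>d2 * f\<close>.\<close>

lemma kloosterman_rep_inj:
  assumes nz: "d1 \<noteq> 0" "d2 \<noteq> 0" "f > 0" and XY: "residue_reps f X" "residue_reps f Y"
  shows "inj_on (\<lambda>p. double_coset (kloosterman_rep d1 d2 f p)) (kloosterman_params d1 d2 f X Y)"
proof (rule inj_onI)
  fix p q assume P: "p \<in> kloosterman_params d1 d2 f X Y" "q \<in> kloosterman_params d1 d2 f X Y"
    and eq: "double_coset (kloosterman_rep d1 d2 f p) = double_coset (kloosterman_rep d1 d2 f q)"
  obtain a a' b b' x y l where p: "p = ((a, a'), (b, b'), (x, y), l)" by (metis surj_pair)
  obtain c c' d d' s t k where q: "q = ((c, c'), (d, d'), (s, t), k)" by (metis surj_pair)
  define M where "M = kloosterman_rep d1 d2 f p"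
  define N where "N = kloosterman_rep d1 d2 f q"
  note p' = P(1)[unfolded p] and q' = P(2)[unfolded q]
  have in_p: "(a, a') \<in> inverse_pairs d1 {0..<\<bar>d1\<bar>} {0..<\<bar>d1\<bar>}" "(b, b') \<in> inverse_pairs d2 {0..<\<bar>d2\<bar>} {0..<\<bar>d2\<bar>}"
      "(x, y) \<in> inverse_pairs f X Y" "l \<in> {0..<f}"
    and in_q: "(c, c') \<in> inverse_pairs d1 {0..<\<bar>d1\<bar>} {0..<\<bar>d1\<bar>}" "(d, d') \<in> inverse_pairs d2 {0..<\<bar>d2\<bar>} {0..<\<bar>d2\<bar>}"
      "(s, t) \<in> inverse_pairs f X Y" "k \<in> {0..<f}"
    using p' q' by (auto simp: kloosterman_params_def)
  note I1 = residue_reps_atLeastLessThan[OF nz(1)] and I2 = residue_reps_atLeastLessThan[OF nz(2)]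
  have "N \<in> double_coset M" using eq double_coset_refl unfolding M_def N_def by blast
  then obtain g h where gh: "g \<in> U3" "h \<in> U3" and N: "N = g ** M ** h"
    by (auto simp: double_coset_def)
  have M3: "M$3$1 = d1 * f" "M$3$2 = f * a" "M$3$3 = y"
    and N3: "N$3$1 = d1 * f" "N$3$2 = f * c" "N$3$3 = t"
    by (simp_all add: M_def N_def p q kloosterman_rep_def Let_def)
  have "M \<in> fine_set d1 d2 f" unfolding M_def by (rule kloosterman_rep_fine_set[OF P(1) nz(3)])
  hence M12: "M$2$1 * M$3$2 - M$2$2 * M$3$1 = d2 * f" unfolding fine_set_def by blast
  have M13: "M$2$1 * M$3$3 - M$2$3 * M$3$1 = y * a' * d2 + d1 * (b' + d2 * l)"
    unfolding M_def p by (rule kloosterman_rep_minor13[OF p'])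
  have N13: "N$2$1 * N$3$3 - N$2$3 * N$3$1 = t * c' * d2 + d1 * (d' + d2 * k)"
    unfolding N_def q by (rule kloosterman_rep_minor13[OF q'])
  have r2: "N$3$2 = M$3$2 + h$1$2 * M$3$1" and r3: "N$3$3 = M$3$3 + h$1$3 * M$3$1 + h$2$3 * M$3$2"
    and m13: "N$2$1 * N$3$3 - N$2$3 * N$3$1 =
      (M$2$1 * M$3$3 - M$2$3 * M$3$1) + h$2$3 * (M$2$1 * M$3$2 - M$2$2 * M$3$1)"
    using gh unfolding N by (simp_all add: U3_def mult3_nth forall_3 algebra_simps)
  have "f * c = f * (a + h$1$2 * d1)" using r2 by (simp add: M3 N3 algebra_simps)
  hence "c = a + h$1$2 * d1" using nz by simp
  hence "[a = c] (mod d1)" by (simp add: cong_iff_dvd_diff)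
  hence a: "a = c" "a' = c'" using inverse_pairs_eqI[OF I1 I1 in_p(1) in_q(1)] by auto
  have "t = y + f * (h$1$3 * d1 + h$2$3 * a)" using r3 by (simp add: M3 N3 algebra_simps)
  hence "[y = t] (mod f)" by (simp add: cong_iff_dvd_diff)
  hence y: "y = t" "x = s"
    using inverse_pairs_eqI[OF XY(2,1)] in_p(3) in_q(3) inverse_pairs_swap by blast+
  \<comment> \<open>With equal bottom rows, \<open>h\<close> must fix the last entry. As
    \<open>a\<close> is a unit modulo \<open>d1\<close>, this makes \<open>h$2$3\<close> a multiple
    \<open>d1 * j\<close>, so the minor can only move by multiples of
    \<open>d1 * d2 * f\<close>.\<close>
  have "h$1$3 * d1 + h$2$3 * a = 0" using \<open>t = y + _\<close> y nz by simp
  hence "h$2$3 * a = d1 * (- h$1$3)" by (simp add: algebra_simps)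
  hence "d1 dvd h$2$3 * a" by (rule dvdI)
  moreover have "coprime d1 a"
    using in_p(1) coprime_iff_invertible_int by (auto simp: inverse_pairs_def coprime_commute)
  ultimately obtain j where j: "h$2$3 = d1 * j"
    by (metis coprime_dvd_mult_left_iff dvdE)
  have "d1 * (d' + d2 * k) = d1 * (b' + d2 * l + d2 * (j * f))"
    using m13 unfolding M12 M13 N13 j a[symmetric] y[symmetric] by (simp add: algebra_simps)
  hence b: "d' + d2 * k = b' + d2 * l + d2 * (j * f)" using nz by simp
  hence "b' - d' = d2 * (k - l - j * f)" by (simp add: algebra_simps)
  hence "[b' = d'] (mod d2)" by (simp add: cong_iff_dvd_diff)
  hence b': "b' = d'" "b = d"
    using inverse_pairs_eqI[OF I2 I2] in_p(2) in_q(2) inverse_pairs_swap by blast+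
  have "d2 * k = d2 * (l + j * f)" using b b' by (simp add: algebra_simps)
  hence "k = l + j * f" using nz by simp
  hence "k mod f = l mod f" by simp
  hence "k = l" using in_p(4) in_q(4) by simp
  thus "p = q" using p q a b' y by simp
qed

text \<open>The parameters are read off the bottom row and bottom minors of \<open>A\<close>. A
  right factor \<open>h\<close> moves these to the values of the representative, and
  \<open>U3_left_equiv\<close> supplies the left factor.\<close>

lemma kloosterman_rep_surj:
  assumes nz: "d1 \<noteq> 0" "d2 \<noteq> 0" "f > 0" and XY: "residue_reps f X" "residue_reps f Y"
    and A: "A \<in> fine_set d1 d2 f"
  shows "\<exists>p \<in> kloosterman_params d1 d2 f X Y. double_coset A = double_coset (kloosterman_rep d1 d2 f p)"
proof -
  note I1 = residue_reps_atLeastLessThan[OF nz(1)] and I2 = residue_reps_atLeastLessThan[OF nz(2)]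
  have dA: "det A = 1" and A31: "A$3$1 = d1 * f" and gA: "gcd (A$3$1) (A$3$2) = f"
    and A12: "A$2$1 * A$3$2 - A$2$2 * A$3$1 = d2 * f"
    using A by (auto simp: fine_set_def SL3_def)
  define B2 where "B2 = A$2$1 * A$3$3 - A$2$3 * A$3$1"
  define B3 where "B3 = A$2$2 * A$3$3 - A$2$3 * A$3$2"
  have "f dvd A$3$2" using gA by (metis gcd_dvd2)
  then obtain a0 where a0: "A$3$2 = f * a0" by blast
  have "f * gcd d1 a0 = f"
    using gA nz(3) gcd_mult_distrib_int[of f d1 a0] unfolding A31 a0 by (simp add: mult.commute)
  hence "coprime a0 d1" using nz by (simp add: coprime_iff_gcd_eq_1 gcd.commute)
  then obtain a a' where aa: "(a, a') \<in> inverse_pairs d1 {0..<\<bar>d1\<bar>} {0..<\<bar>d1\<bar>}" and "[a = a0] (mod d1)"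
    using inverse_pairs_obtain[OF I1 I1] by metis
  then obtain h12 where h12: "a = a0 + d1 * h12"
    by (metis cong_iff_lin cong_sym)
  have "[a * a' = 1] (mod d1)" using aa by (simp add: inverse_pairs_def)
  from cong_one_imp_bezout[OF this] obtain e0 where "a * a' + d1 * e0 = 1" by blast
  \<comment> \<open>Transfers the Bezout identity from the reduced \<open>a\<close> back to the
    original \<open>a0\<close>.\<close>
  then obtain e where e: "a0 * a' + d1 * e = 1"
    by (rule_tac that[of "e0 + h12 * a'"]) (simp add: h12 algebra_simps)
  have det: "A$1$1 * B3 - A$1$2 * B2 + A$1$3 * (d2 * f) = 1"
    using dA unfolding A12[symmetric] B2_def B3_def det_3 by (simp add: algebra_simps)
  \<comment> \<open>The Pluecker relation of the bottom two rows, from which a factor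
    \<open>f\<close> cancels.\<close>
  have "f * (d1 * B3) = f * (a0 * B2 - A$3$3 * d2)"
    using A12 A31 a0 unfolding B2_def B3_def by algebra
  hence pl: "d1 * B3 = a0 * B2 - A$3$3 * d2" using nz by simp
  \<comment> \<open>In the expansion of the determinant along the bottom row, the first two entries
    are multiples of \<open>f\<close>, so the last entry is a unit modulo \<open>f\<close>.\<close>
  have "f dvd (A$1$1 * A$2$2 - A$1$2 * A$2$1) * A$3$3 - 1"
  proof -
    have "(A$1$1 * A$2$2 - A$1$2 * A$2$1) * A$3$3 - 1 =
        f * ((A$1$1 * A$2$3 - A$1$3 * A$2$1) * a0 - (A$1$2 * A$2$3 - A$1$3 * A$2$2) * d1)"
      using dA A31 a0 unfolding det_3 by algebra
    thus ?thesis by simp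
  qed
  hence "coprime (A$3$3) f"
    by (metis cong_iff_dvd_diff coprime_iff_invertible_int mult.commute)
  then obtain x y where xy: "(x, y) \<in> inverse_pairs f X Y" "[y = A$3$3] (mod f)"
    using inverse_pairs_obtain[OF XY(2,1)] inverse_pairs_swap by metis
  then obtain t where t: "y = A$3$3 + f * t"
    by (metis cong_iff_lin cong_sym)
  \<comment> \<open>This definition and the Pluecker relation \<open>pl\<close> form a linear system
    for \<open>B2\<close> and \<open>B3\<close> of determinant \<open>a0 * a' + d1 * e = 1\<close>;
    solving it writes both minors in terms of \<open>\<beta>0\<close>.\<close>
  define \<beta>0 where "\<beta>0 = a' * B3 + e * B2"
  have B2: "B2 = A$3$3 * a' * d2 + d1 * \<beta>0" and B3: "B3 = a0 * \<beta>0 - e * d2 * A$3$3"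
    using pl e unfolding \<beta>0_def by algebra+
  \<comment> \<open>Inserting these minors into the expansion of the determinant along the top row
    gives a Bezout identity for \<open>\<beta>0\<close> and \<open>d2\<close>.\<close>
  have "\<beta>0 * (A$1$1 * a0 - A$1$2 * d1) + d2 * (A$1$3 * f - A$1$1 * e * A$3$3 - A$1$2 * A$3$3 * a') = 1"
    using det B2 B3 by algebra
  hence "coprime \<beta>0 d2"
    by (intro coprimeI) (metis dvd_add dvd_mult2)
  then obtain b b' where bb: "(b, b') \<in> inverse_pairs d2 {0..<\<bar>d2\<bar>} {0..<\<bar>d2\<bar>}" "[b' = \<beta>0] (mod d2)"
    using inverse_pairs_obtain[OF I2 I2] inverse_pairs_swap by metis
  then obtain l0 where l0: "\<beta>0 = b' + d2 * l0" by (metis cong_iff_lin)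
  define l where "l = l0 mod f"
  define j where "j = - (l0 div f)"
  have lj: "l = l0 + f * j" unfolding l_def j_def by (simp add: minus_div_mult_eq_mod [symmetric] algebra_simps)
  have l: "l \<in> {0..<f}" using nz by (simp add: l_def)
  let ?p = "((a, a'), (b, b'), (x, y), l)"
  have p: "?p \<in> kloosterman_params d1 d2 f X Y"
    using aa bb xy l by (simp add: kloosterman_params_def)
  define M where "M = kloosterman_rep d1 d2 f ?p"
  have M3: "M$3$1 = d1 * f" "M$3$2 = f * a" "M$3$3 = y"
    by (simp_all add: M_def kloosterman_rep_def Let_def)
  have M: "M \<in> fine_set d1 d2 f" unfolding M_def by (rule kloosterman_rep_fine_set[OF p nz(3)])
  hence M12: "M$2$1 * M$3$2 - M$2$2 * M$3$1 = d2 * f" and dM: "det M = 1"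
    unfolding fine_set_def SL3_def by blast+
  have M13: "M$2$1 * M$3$3 - M$2$3 * M$3$1 = y * a' * d2 + d1 * (b' + d2 * l)"
    unfolding M_def by (rule kloosterman_rep_minor13[OF p])
  \<comment> \<open>\<open>h12\<close> turns \<open>a0\<close> into \<open>a\<close>. Column 3
    solves two equations: the last entry must grow by \<open>f * t\<close> and the minor
    \<open>B2\<close> by \<open>d2 * f * (a' * t + d1 * j)\<close>. The second gives
    \<open>h$2$3\<close>, and then the first gives \<open>h$1$3\<close>.\<close>
  define h where "h = mat3 1 h12 (e * t - a0 * j) 0 1 (a' * t + d1 * j) 0 0 1"
  define N where "N = A ** h"
  have h: "h \<in> U3" by (simp add: h_def U3_def forall_3)
  have "det h = 1" by (simp add: h_def det_3)
  hence dN: "det N = 1" using dA by (simp add: N_def det_mul)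
  have N3: "N$3$1 = d1 * f" "N$3$2 = f * a"
    by (simp_all add: N_def h_def mult3_nth A31 a0 h12 algebra_simps)
  have "N$3$3 = A$3$3 + f * ((a0 * a' + d1 * e) * t)"
    by (simp add: N_def h_def mult3_nth A31 a0 algebra_simps)
  hence N33: "N$3$3 = y" by (simp add: e t)
  have N12: "N$2$1 * N$3$2 - N$2$2 * N$3$1 = d2 * f"
    using A12 by (simp add: N_def h_def mult3_nth algebra_simps)
  have "N$2$1 * N$3$3 - N$2$3 * N$3$1 = B2 + (a' * t + d1 * j) * (A$2$1 * A$3$2 - A$2$2 * A$3$1)"
    by (simp add: N_def h_def mult3_nth B2_def algebra_simps)
  also have "\<dots> = y * a' * d2 + d1 * (b' + d2 * l)"
    unfolding A12 B2 l0 lj t by (simp add: algebra_simps)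
  finally have N13: "N$2$1 * N$3$3 - N$2$3 * N$3$1 = y * a' * d2 + d1 * (b' + d2 * l)" .
  have "\<exists>g \<in> U3. N = g ** M"
    using nz by (intro U3_left_equiv[OF dN dM _ _ _ _ trans[OF M12 N12[symmetric]] trans[OF M13 N13[symmetric]]])
      (simp_all add: N3 N33 M3)
  hence "N \<in> double_coset M" using double_coset_leftI by blast
  moreover have "N \<in> double_coset A" unfolding N_def by (rule double_coset_rightI[OF h])
  ultimately have "double_coset A = double_coset M" using double_coset_eq by metis
  thus ?thesis using p unfolding M_def by blast
qed

section \<open>Evaluation of the sum\<close>

text \<open>Reindexes the double cosets by the parameters; the element picked by \<open>SOME\<close>
  may be exchanged for \<open>kloosterman_rep\<close> because the summand is constant on a double
  coset.\<close>

lemma fine_kloosterman_params_sum: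
  assumes nz: "d1 \<noteq> 0" "d2 \<noteq> 0" "f > 0" and XY: "residue_reps f X" "residue_reps f Y"
  shows "fine_kloosterman m n d1 d2 f = (\<Sum>p \<in> kloosterman_params d1 d2 f X Y.
    psi m (u_L (map_matrix real_of_int (kloosterman_rep d1 d2 f p))) *
    psi n (u_R (map_matrix real_of_int (kloosterman_rep d1 d2 f p))))"
proof -
  let ?P = "kloosterman_params d1 d2 f X Y" and ?C = "\<lambda>p. double_coset (kloosterman_rep d1 d2 f p)"
  let ?F = "\<lambda>A. psi m (u_L (map_matrix real_of_int A)) * psi n (u_R (map_matrix real_of_int A))"
  have "double_coset ` fine_set d1 d2 f = ?C ` ?P"
    using kloosterman_rep_surj[OF nz XY] kloosterman_rep_fine_set[OF _ nz(3)] by blast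
  hence "fine_kloosterman m n d1 d2 f = (\<Sum>p \<in> ?P. ?F (SOME A. A \<in> ?C p))"
    by (simp add: fine_kloosterman_def Let_def sum.reindex[OF kloosterman_rep_inj[OF nz XY]] o_def)
  also have "\<dots> = (\<Sum>p \<in> ?P. ?F (kloosterman_rep d1 d2 f p))"
  proof (rule sum.cong[OF refl])
    fix p assume p: "p \<in> ?P"
    have "(SOME A. A \<in> ?C p) \<in> ?C p" using double_coset_refl by (rule someI)
    thus "?F (SOME A. A \<in> ?C p) = ?F (kloosterman_rep d1 d2 f p)"
      by (rule summand_double_coset[OF kloosterman_rep_fine_set[OF p nz(3)] _ nz])
  qed
  finally show ?thesis .
qed

lemma psi_product_kloosterman_rep:
  fixes d1 d2 f :: int
  assumes p: "((a, a'), (b, b'), (x, y), l) \<in> kloosterman_params d1 d2 f X Y"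
    and nz: "d1 \<noteq> 0" "d2 \<noteq> 0" "f > 0"
  defines "R \<equiv> map_matrix real_of_int (kloosterman_rep d1 d2 f ((a, a'), (b, b'), (x, y), l))"
  shows "psi (m1, m2) (u_L R) * psi (n1, n2) (u_R R) =
    ee ((n1 * a + (m2 * d2 + n2 * d1 * y) / f * a') / d1) *
    ee ((m1 * b + (n2 * d1 + m2 * d2 * x) / f * b') / d2) *
    ee (of_int ((n2 * d1 + m2 * d2 * x) * l) / of_int f)"
proof -
  define M where "M = kloosterman_rep d1 d2 f ((a, a'), (b, b'), (x, y), l)"
  obtain e h z where bez: "a * a' + d1 * e = 1" and M: "M =
      mat3 (b * a' - x * h * d1) (- x * h * a - b * e) (z * h)
         (x * (b' + d2 * l) * d1 + d2 * a') (x * (b' + d2 * l) * a - d2 * e) (- z * (b' + d2 * l))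
         (d1 * f) (f * a) y"
    using kloosterman_rep_bezout[OF p] unfolding M_def by metis
  have M13: "M$2$1 * M$3$3 - M$2$3 * M$3$1 = y * a' * d2 + d1 * (b' + d2 * l)"
    unfolding M_def by (rule kloosterman_rep_minor13[OF p])
  have u12: "M$1$1 * M$3$2 - M$1$2 * M$3$1 = b * f"
    unfolding M mat3_nth using bez by algebra
  have M21: "M$2$1 = x * (b' + d2 * l) * d1 + d2 * a'" and M32: "M$3$2 = f * a" by (simp_all add: M)
  \<comment> \<open>The mixed term \<open>m2 * x * b' / f\<close> from the left unipotent goes to
    the \<open>b\<close> factor and \<open>n2 * y * a' / f\<close> from the right one to the
    \<open>a\<close> factor. The quotients by \<open>f\<close> are still real here.\<close>
  have split: "m1 * (b * f) / (d2 * f) + m2 * (x * (b' + d2 * l) * d1 + d2 * a') / (d1 * f) + n1 * (f * a) / (d1 * f)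
        + n2 * (y * a' * d2 + d1 * (b' + d2 * l)) / (d2 * f) =
      (n1 * a + (m2 * d2 + n2 * d1 * y) / f * a') / d1 + (m1 * b + (n2 * d1 + m2 * d2 * x) / f * b') / d2
        + (n2 * d1 + m2 * d2 * x) * l / f"
    if "d1 \<noteq> 0" "d2 \<noteq> 0" "f \<noteq> 0" for m1 m2 n1 n2 a a' b b' x y l d1 d2 f :: real
  proof -
    have "m2 * (x * (b' + d2 * l) * d1 + d2 * a') / (d1 * f) = m2 * x * b' / f + m2 * x * d2 * l / f + m2 * d2 * a' / (d1 * f)"
      "n2 * (y * a' * d2 + d1 * (b' + d2 * l)) / (d2 * f) = n2 * y * a' / f + n2 * d1 * b' / (d2 * f) + n2 * d1 * l / f"
      "(n1 * a + (m2 * d2 + n2 * d1 * y) / f * a') / d1 = n1 * a / d1 + m2 * d2 * a' / (d1 * f) + n2 * y * a' / f"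
      "(m1 * b + (n2 * d1 + m2 * d2 * x) / f * b') / d2 = m1 * b / d2 + n2 * d1 * b' / (d2 * f) + m2 * x * b' / f"
      "(n2 * d1 + m2 * d2 * x) * l / f = n2 * d1 * l / f + m2 * x * d2 * l / f"
      using that by (simp_all add: field_simps)
    thus ?thesis using that by simp
  qed
  show ?thesis
    unfolding R_def M_def[symmetric]
      psi_product_fine_set[OF kloosterman_rep_fine_set[OF p nz(3)] nz, folded M_def] M13 u12 ee_add[symmetric]
    unfolding M21 M32
    using split[of d1 d2 f m1 b m2 x b' l a' n1 a n2 y] nz by simp
qed

text \<open>Modulo \<open>f\<close> the two expressions differ by the unit \<open>x\<close>. The sum
  over \<open>l\<close> yields a condition on \<open>x\<close>, and this turns it into the stated
  one on \<open>y\<close>.\<close>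

lemma unit_multiple_dvd_iff:
  fixes f :: int
  assumes "[x * y = 1] (mod f)"
  shows "f dvd v + u * x \<longleftrightarrow> f dvd u + v * y"
proof -
  obtain z where z: "x * y + f * z = 1" using cong_one_imp_bezout[OF assms] by blast
  have "v + u * x = x * (u + v * y) + f * (z * v)" "u + v * y = y * (v + u * x) + f * (z * u)"
    using z by algebra+
  thus ?thesis by (metis dvd_add dvd_mult dvd_triv_left)
qed

text \<open>Both halves of the theorem come from this formula; when the gcds differ, its index set
  is empty.\<close>

lemma fine_kloosterman_eq:
  fixes d1 d2 f m1 m2 n1 n2 :: int
  assumes nz: "d1 \<noteq> 0" "d2 \<noteq> 0" "f > 0" and XY: "residue_reps f X" "residue_reps f Y"
  shows "fine_kloosterman (m1, m2) (n1, n2) d1 d2 f =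
     of_int f * (\<Sum>(x, y) \<in> {(x, y). x \<in> X \<and> y \<in> Y \<and> [x * y = 1] (mod f) \<and>
                                  [m2 * d2 + n2 * d1 * y = 0] (mod f)}.
       kloosterman n1 ((m2 * d2 + n2 * d1 * y) div f) d1 *
       kloosterman m1 ((n2 * d1 + m2 * d2 * x) div f) d2)"
proof -
  define I1 where "I1 = inverse_pairs d1 {0..<\<bar>d1\<bar>} {0..<\<bar>d1\<bar>}"
  define I2 where "I2 = inverse_pairs d2 {0..<\<bar>d2\<bar>} {0..<\<bar>d2\<bar>}"
  define I3 where "I3 = inverse_pairs f X Y"
  define K where "K y = m2 * d2 + n2 * d1 * y" for y
  define L where "L x = n2 * d1 + m2 * d2 * x" for x
  define F where "F a a' y = ee ((n1 * a + K y / f * a') / d1)" for a a' y :: int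
  define G where "G b b' x = ee ((m1 * b + L x / f * b') / d2)" for b b' x :: int
  define H where "H x l = ee (of_int (L x * l) / of_int f)" for x l
  have H: "(\<Sum>l\<in>{0..<f}. H x l) = (if f dvd L x then of_int f else 0)" for x
    unfolding H_def by (rule sum_ee_linear[OF nz(3)])
  have KL: "f dvd L x \<longleftrightarrow> f dvd K y" if "(x, y) \<in> I3" for x y
    unfolding K_def L_def using that by (intro unit_multiple_dvd_iff) (auto simp: I3_def inverse_pairs_def)
  \<comment> \<open>If \<open>f\<close> does not divide \<open>K y\<close>, the first two factors
    have non-integral frequencies, but the sum over \<open>l\<close> vanishes. Otherwise the
    divisions by \<open>f\<close> are exact and these factors are classical Kloosterman
    sums.\<close>
  have summand: "(\<Sum>(a, a') \<in> I1. F a a' y) * (\<Sum>(b, b') \<in> I2. G b b' x) * (\<Sum>l \<in> {0..<f}. H x l) =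
      (if f dvd K y then of_int f * (kloosterman n1 (K y div f) d1 * kloosterman m1 (L x div f) d2) else 0)"
    if xy: "(x, y) \<in> I3" for x y
  proof (cases "f dvd K y")
    case True
    hence "real_of_int (K y div f) = K y / f" "real_of_int (L x div f) = L x / f"
      using KL[OF xy] by (simp_all add: real_of_int_div)
    hence "(\<Sum>(a, a') \<in> I1. F a a' y) = kloosterman n1 (K y div f) d1"
      "(\<Sum>(b, b') \<in> I2. G b b' x) = kloosterman m1 (L x div f) d2"
      unfolding kloosterman_inverse_pairs I1_def I2_def F_def G_def by simp_all
    thus ?thesis using True KL[OF xy] by (simp add: H)
  qed (use KL[OF xy] in \<open>simp add: H\<close>)
  have P: "kloosterman_params d1 d2 f X Y = I1 \<times> I2 \<times> I3 \<times> {0..<f}"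
    by (simp add: kloosterman_params_def I1_def I2_def I3_def)
  have "fine_kloosterman (m1, m2) (n1, n2) d1 d2 f =
      (\<Sum>((a, a'), (b, b'), (x, y), l) \<in> I1 \<times> I2 \<times> I3 \<times> {0..<f}. F a a' y * G b b' x * H x l)"
    unfolding fine_kloosterman_params_sum[OF nz XY] P[symmetric]
  proof (rule sum.cong[OF refl])
    fix p assume p: "p \<in> kloosterman_params d1 d2 f X Y"
    obtain a a' b b' x y l where p': "p = ((a, a'), (b, b'), (x, y), l)" by (metis surj_pair)
    show "psi (m1, m2) (u_L (map_matrix real_of_int (kloosterman_rep d1 d2 f p))) *
        psi (n1, n2) (u_R (map_matrix real_of_int (kloosterman_rep d1 d2 f p))) =
        (\<lambda>((a, a'), (b, b'), (x, y), l). F a a' y * G b b' x * H x l) p"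
      using psi_product_kloosterman_rep[OF p[unfolded p'] nz]
      by (simp add: p' F_def G_def H_def K_def L_def)
  qed
  also have "\<dots> = (\<Sum>(a, a') \<in> I1. \<Sum>(b, b') \<in> I2. \<Sum>(x, y) \<in> I3. \<Sum>l \<in> {0..<f}. F a a' y * G b b' x * H x l)"
    by (simp add: case_prod_unfold sum.cartesian_product)
  \<comment> \<open>The sum over \<open>(x, y)\<close> is moved outermost: for a fixed pair the sums
    over \<open>(a, a')\<close>, \<open>(b, b')\<close> and \<open>l\<close> are independent and
    factor.\<close>
  also have "\<dots> = (\<Sum>(a, a') \<in> I1. \<Sum>(x, y) \<in> I3. \<Sum>(b, b') \<in> I2. \<Sum>l \<in> {0..<f}. F a a' y * G b b' x * H x l)"
    unfolding case_prod_unfold by (rule sum.cong[OF refl], rule sum.swap)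
  also have "\<dots> = (\<Sum>(x, y) \<in> I3. \<Sum>(a, a') \<in> I1. \<Sum>(b, b') \<in> I2. \<Sum>l \<in> {0..<f}. F a a' y * G b b' x * H x l)"
    unfolding case_prod_unfold by (rule sum.swap)
  also have "\<dots> = (\<Sum>(x, y) \<in> I3. (\<Sum>(a, a') \<in> I1. F a a' y) * (\<Sum>(b, b') \<in> I2. G b b' x) * (\<Sum>l \<in> {0..<f}. H x l))"
    by (simp only: case_prod_unfold sum_distrib_left[symmetric] sum_distrib_right[symmetric])
  also have "\<dots> = (\<Sum>(x, y) \<in> I3. if f dvd K y then
      of_int f * (kloosterman n1 (K y div f) d1 * kloosterman m1 (L x div f) d2) else 0)"
    by (rule sum.cong[OF refl], clarify, simp only: split_conv summand)
  also have "\<dots> = (\<Sum>(x, y) \<in> {p \<in> I3. f dvd K (snd p)}.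
      of_int f * (kloosterman n1 (K y div f) d1 * kloosterman m1 (L x div f) d2))"
    using inverse_pairs_finite[OF _ XY] nz unfolding I3_def case_prod_unfold
    by (subst sum.inter_filter) simp_all
  also have "{p \<in> I3. f dvd K (snd p)} = {(x, y). x \<in> X \<and> y \<in> Y \<and> [x * y = 1] (mod f) \<and> [K y = 0] (mod f)}"
    by (auto simp: I3_def inverse_pairs_def cong_0_iff)
  finally show ?thesis unfolding K_def L_def by (simp add: sum_distrib_left case_prod_unfold)
qed

theorem theorem5p10:
  fixes d1 d2 f m1 m2 n1 n2 :: int
  assumes "d1 \<noteq> 0" and "d2 \<noteq> 0" and "f > 0"
  shows "(gcd (m2 * d2) f \<noteq> gcd (n2 * d1) f \<longrightarrow>
           fine_kloosterman (m1, m2) (n1, n2) d1 d2 f = 0) \<and>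
         (gcd (m2 * d2) f = gcd (n2 * d1) f \<longrightarrow>
           (\<forall>X Y. residue_reps f X \<and> residue_reps f Y \<longrightarrow>
             fine_kloosterman (m1, m2) (n1, n2) d1 d2 f =
             of_int f * (\<Sum>(x, y) \<in> {(x, y). x \<in> X \<and> y \<in> Y \<and> [x * y = 1] (mod f) \<and>
                                          [m2 * d2 + n2 * d1 * y = 0] (mod f)}.
               kloosterman n1 ((m2 * d2 + n2 * d1 * y) div f) d1 *
               kloosterman m1 ((n2 * d1 + m2 * d2 * x) div f) d2)))"
proof (intro conjI impI allI)
  assume neq: "gcd (m2 * d2) f \<noteq> gcd (n2 * d1) f"
  \<comment> \<open>Multiplying by the unit \<open>y\<close> preserves the gcd with
    \<open>f\<close>, so a solution of the congruence would force the two gcds to be equal.\<close>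
  have empty: "\<not> ([x * y = 1] (mod f) \<and> [m2 * d2 + n2 * d1 * y = 0] (mod f))" for x y
  proof
    assume xy: "[x * y = 1] (mod f) \<and> [m2 * d2 + n2 * d1 * y = 0] (mod f)"
    hence "f dvd m2 * d2 + n2 * d1 * y" by (simp add: cong_0_iff)
    hence "[m2 * d2 = - (n2 * d1 * y)] (mod f)" by (simp add: cong_iff_dvd_diff)
    hence "gcd (m2 * d2) f = gcd (- (n2 * d1 * y)) f" by (rule cong_gcd_eq)
    moreover have "coprime y f" using xy coprime_iff_invertible_int by (metis mult.commute)
    ultimately show False using neq by (simp add: gcd_mult_left_right_cancel coprime_commute)
  qed
  \<comment> \<open>The vanishing claim names no representatives modulo \<open>f\<close>, so the
    standard ones are supplied.\<close>
  have "residue_reps f {0..<\<bar>f\<bar>}" using assms by (intro residue_reps_atLeastLessThan) simp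
  from fine_kloosterman_eq[OF assms this this] show "fine_kloosterman (m1, m2) (n1, n2) d1 d2 f = 0"
    by (simp add: empty)
qed (use fine_kloosterman_eq[OF assms] in blast)

end
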